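(* Let $\Sigma_{\max}$ be the summation system on $\mathbb R$ given by unconditional summation with respect to the usual topology and usual addition. There is no summation system on $\mathbb R$ properly extending $\Sigma_{\max}$ and satisfying all of the following properties (with respect to the usual addition, negation and multiplication of $\mathbb R$): reindexing invariance, subfamilies remain summable, empty sum existence, zero means nothing, singletons sum simply, finite-totality, prefix associativity, insertive associativity, monoid merger, additive extension closure, addition functoriality, negation functoriality, ordinal reindexing invariance, initial summability, postfix associativity, ordinal insertive associativity, and infinite distributivity.
   Context: $\mathbb N=\{0,1,2,\dots\}$; $\mathscr P(I)$ is the power set of $I$; $\mathrm{Ord}$ is the class of ordinals. A summation system on a set $X$ is a partial function $\Sigma\colon\bigcup_I X^I\to X$, the union running over all sets $I$ (in a fixed universe, if preferred). A family $\underline a=(a_i)_{i\in I}$ is summable if it lies in $\mathrm{dom}(\Sigma)$; its sum is $\Sigma\underline a$. Extension of summation systems is extension of partial functions. $\Sigma_{\max}$ is the set of pairs $(\underline a,x)$, $\underline a\in\mathbb R^I$ for some set $I$, $x\in\mathbb R$, such that $x$ is the unique real number with: for every open neighborhood $S$ of $0$ in $\mathbb R$ there is a finite $F\subseteq I$ such that $\sum_{i\in F'}a_i-x\in S$ for every finite $F'$ with $F\subseteq F'\subseteq I$. $()$ is the empty family. The core of $(a_i)_{i\in I}$ is its subfamily indexed by $\{i\in I: a_i\neq\Sigma()\}$ (vacuously all of $I$ if $()$ is not summable); $\underline b$ is a core-extension of $\underline a$ if $\underline a$ is a subfamily of $\underline b$ and both have the same core. For $\underline a\in X^I$, $\ell\notin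 I$, $x\in X$, the family $\underline a\#_\ell x\in X^{I\cup\{\ell\}}$ has entry $x$ at $\ell$ and agrees with $\underline a$ on $I$. For $\underline a\in X^I$, $\underline b\in X^J$, the family $\underline a+\underline b\in X^{I\cup J}$ is the componentwise sum after extending both families to $I\cup J$ by zeros; $-\underline a=(-a_i)_{i\in I}$. Properties: - Reindexing invariance: if $\varphi\colon I'\to I$ is a bijection and $(a_i)_{i\in I}$ is summable, then $(a_{\varphi(i')})_{i'\in I'}$ is summable with the same sum. - Subfamilies remain summable: if $I'\subseteq I$ and $(a_i)_{i\in I}$ is summable, then $(a_i)_{i\in I'}$ is summable. - Empty sum existence: $()\in\mathrm{dom}(\Sigma)$. - Zero means nothing: if $\underline b$ is a core-extension of $\underline a$, then $\underline b$ is summable iff $\underline a$ is, and then $\Sigma\underline a=\Sigma\underline b$. - Singletons sum simply: every family indexed by a one-element set is summable, with sum its unique member. - Finite-totality: every family with a finite index set is summable. - Prefix associativity: if $(a_i)_{i\in\mathbb N}$ is summable, then so is $(a_{i+1})_{i\in\mathbb N}$ and $\Sigma(a_i)_{i\in\mathbb N}=a_0+\Sigma(a_{i+1})_{i\in\mathbb N}$. - Insertive associativity: if $(a_i)_{i\in I}$ is summable and $P$ is a partition of $I$, then $\Sigma(a_i)_{i\in I}=\Sigma\big(\Sigma(a_j)_{j\in J}\big)_{J\in P}$, every sum on the right existing. - Monoid merger: if $(a_i)_{i\in I}$ is summable and $\psi\colon K\to\mathscr P(I)$ is such that each $i\in I$ lies in $\psi(k)$ for a unique $k\in K$, then $\Sigma(a_i)_{i\in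 I}=\Sigma\big(\Sigma(a_i)_{i\in\psi(k)}\big)_{k\in K}$, all sums on the right being defined. - Additive extension closure: if $\underline a\in X^I$ is summable, $\ell\notin I$, $x\in X$, then $\underline a\#_\ell x$ is summable with sum $\Sigma\underline a+x$. - Addition functoriality: if $\underline a,\underline b$ are summable, then so is $\underline a+\underline b$, and $\Sigma[\underline a+\underline b]=\Sigma\underline a+\Sigma\underline b$. - Negation functoriality: if $\underline a$ is summable, then so is $-\underline a$, and $\Sigma[-\underline a]=-\Sigma\underline a$. - Ordinal reindexing invariance: if $I,I'\subseteq\mathrm{Ord}$ are sets, $\varphi\colon I'\to I$ is an order isomorphism, and $(a_i)_{i\in I}$ is summable, then $(a_{\varphi(i')})_{i'\in I'}$ is summable with the same sum. - Initial summability: if $I\subseteq\mathrm{Ord}$ is a set and $(a_i)_{i\in I}$ is summable, then each initial segment $(a_j)_{j\in I,\,j<\alpha}$ ($\alpha\in\mathrm{Ord}$) is summable. - Postfix associativity: if $I\subseteq\mathrm{Ord}$ is a set with a last element $m$ and $(a_i)_{i\in I}$ is summable, then $(a_i)_{i\in I\setminus\{m\}}$ is summable and $\Sigma(a_i)_{i\in I}=\Sigma(a_i)_{i\in I\setminus\{m\}}+a_m$. - Ordinal insertive associativity: if $I\subseteq\mathrm{Ord}$ is a set, $(a_i)_{i\in I}$ is summable, and $\{J_k\}_{k\in K}$ is a partition of $I$ into (nonempty) subintervals indexed by a transversal $K$ with $k\in J_k$ for each $k\in K$, then $\Sigma(a_i)_{i\in I}=\Sigma\big(\Sigma(a_i)_{i\in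 J_k}\big)_{k\in K}$, all sums on the right existing. - Infinite distributivity: if $(a_i)_{i\in I}$ and $(b_j)_{j\in J}$ are summable, then so is $(a_ib_j)_{(i,j)\in I\times J}$, and $[\Sigma(a_i)_{i\in I}][\Sigma(b_j)_{j\in J}]=\Sigma(a_ib_j)_{(i,j)\in I\times J}$. *)

theory Defs
  imports
    "HOL-Analysis.Infinite_Sum"
    "HOL-Library.Disjoint_Sets"
    "HOL-Library.Countable_Set_Type"
begin

section \<open>Universes of sets\<close>

text \<open>
  HOL has no type of all sets, so index sets are taken from a universe: a type whose elements
  are sets with elements in the same type.  Theorems about this class hold for every universe.
  A Grothendieck universe containing an infinite set is an instance; so is the universe of
  all sets.  Power sets are not demanded, as index sets are only ever formed by taking subsets,
  images, partitions and products.  This makes the class inhabited in plain HOL, see below.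
\<close>

class set_universe =
  fixes elts :: "'a \<Rightarrow> 'a set"
  assumes extensionality: "elts x = elts y \<Longrightarrow> x = y"
    and foundation: "wf {(x, y). x \<in> elts y}"
    and pairing: "\<exists>z. elts z = {x, y}"
    and union: "\<exists>z. elts z = (\<Union>y\<in>elts x. elts y)"
    and separation: "\<exists>z. elts z = {y \<in> elts x. P y}"
    and replacement: "\<exists>z. elts z = f ` elts x"
    and infinity: "\<exists>z. (\<exists>e\<in>elts z. elts e = {}) \<and>
                      (\<forall>x\<in>elts z. \<exists>y\<in>elts z. elts y = insert x (elts x))"

text \<open>
  A subset of the type is \<open>small\<close> if it is (the extension of) a set of the universe; \<open>mk_set X\<close>
  is that set, and is meaningful only for small \<open>X\<close>.
\<close>

definition small :: "'u::set_universe set \<Rightarrow> bool" where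
  "small X \<longleftrightarrow> X \<in> range elts"

definition mk_set :: "'u::set_universe set \<Rightarrow> 'u" where
  "mk_set = inv elts"

lemma elts_mk_set: "small X \<Longrightarrow> elts (mk_set X) = X"
  unfolding small_def mk_set_def by (rule f_inv_into_f)

lemma small_pair: "small {x, y}"
  unfolding small_def using pairing by (metis rangeI)

definition vsuc :: "'u::set_universe \<Rightarrow> 'u" where
  "vsuc x = mk_set (insert x (elts x))"

primrec vnat :: "nat \<Rightarrow> 'u::set_universe" where
  "vnat 0 = mk_set {}"
| "vnat (Suc n) = vsuc (vnat n)"

definition vpair :: "'u::set_universe \<Rightarrow> 'u \<Rightarrow> 'u" where
  "vpair x y = mk_set {mk_set {x}, mk_set {x, y}}"

lemma vpair_inject: "vpair x y = vpair x' y' \<longleftrightarrow> x = x' \<and> y = y'"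
proof
  assume eq: "vpair x y = vpair x' y'"
  have "(`) elts (elts (vpair u v)) = {{u}, {u, v}}" for u v :: 'a
    using elts_mk_set[OF small_pair[of u u]]
    by (simp add: vpair_def elts_mk_set small_pair)
  then have "{{x}, {x, y}} = {{x'}, {x', y'}}"
    using eq by metis
  then show "x = x' \<and> y = y'"
    by (auto simp: doubleton_eq_iff)
qed simp

definition vfst :: "'u::set_universe \<Rightarrow> 'u" where
  "vfst p = (THE x. \<exists>y. p = vpair x y)"

definition vsnd :: "'u::set_universe \<Rightarrow> 'u" where
  "vsnd p = (THE y. \<exists>x. p = vpair x y)"

definition vtimes :: "'u::set_universe set \<Rightarrow> 'u set \<Rightarrow> 'u set" where
  "vtimes I J = {vpair i j |i j. i \<in> I \<and> j \<in> J}"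

text \<open>Von Neumann ordinals; in view of foundation, hereditary transitivity suffices.\<close>

definition vtransitive :: "'u::set_universe \<Rightarrow> bool" where
  "vtransitive x \<longleftrightarrow> (\<forall>y\<in>elts x. elts y \<subseteq> elts x)"

definition Ord :: "'u::set_universe set" where
  "Ord = {x. vtransitive x \<and> (\<forall>y\<in>elts x. vtransitive y)}"

abbreviation ord_less :: "'u::set_universe \<Rightarrow> 'u \<Rightarrow> bool"  (infix "\<lless>" 50) where
  "\<alpha> \<lless> \<beta> \<equiv> \<alpha> \<in> elts \<beta>"


subsection \<open>The hereditarily countable sets form a universe\<close>

datatype hcset = HC (hc_elements: "hcset cset")

instantiation hcset :: set_universe
begin

definition elts_hcset :: "hcset \<Rightarrow> hcset set" where
  "elts_hcset x = rcset (hc_elements x)"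

lemma hc_ex: "countable X \<Longrightarrow> \<exists>z::hcset. elts z = X"
  by (rule exI[of _ "HC (acset X)"]) (simp add: elts_hcset_def)

lemma countable_hc_elts: "countable (elts (x::hcset))"
  by (simp add: elts_hcset_def)

instance
proof
  fix x y :: hcset
  show "elts x = elts y \<Longrightarrow> x = y"
    by (simp add: elts_hcset_def rcset_inject hcset.expand)
  show "\<exists>z. elts z = {x, y}"
    by (rule hc_ex) simp
  show "\<exists>z. elts z = (\<Union>y\<in>elts x. elts y)"
    by (rule hc_ex) (simp add: countable_hc_elts)
  show "\<exists>z. elts z = {y \<in> elts x. P y}" for P
    by (rule hc_ex) (simp add: countable_hc_elts)
  show "\<exists>z. elts z = f ` elts x" for f :: "hcset \<Rightarrow> hcset"
    by (rule hc_ex) (simp add: countable_hc_elts)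
next
  show "wf {(x, y :: hcset). x \<in> elts y}"
    unfolding wf_def
  proof (intro allI impI)
    fix P :: "hcset \<Rightarrow> bool" and x :: hcset
    assume step: "\<forall>x. (\<forall>y. (y, x) \<in> {(x, y). x \<in> elts y} \<longrightarrow> P y) \<longrightarrow> P x"
    show "P x"
    proof (induction x)
      case (HC c)
      then have "\<forall>y. (y, HC c) \<in> {(x, y). x \<in> elts y} \<longrightarrow> P y"
        by (simp add: elts_hcset_def cin.rep_eq)
      then show ?case
        by (rule step[THEN spec, THEN mp])
    qed
  qed
next
  define f :: "nat \<Rightarrow> hcset" where
    "f = rec_nat (HC (acset {})) (\<lambda>_ x. HC (acset (insert x (elts x))))"
  have f0: "elts (f 0) = {}"
    by (simp add: f_def elts_hcset_def)
  have fSuc: "elts (f (Suc n)) = insert (f n) (elts (f n))" for n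
    by (simp add: f_def elts_hcset_def)
  obtain z :: hcset where "elts z = range f"
    using hc_ex[of "range f"] by auto
  moreover have "\<forall>x\<in>range f. \<exists>y\<in>range f. elts y = insert x (elts x)"
    using fSuc by blast
  moreover have "\<exists>e\<in>range f. elts e = {}"
    using f0 by blast
  ultimately show "\<exists>z::hcset. (\<exists>e\<in>elts z. elts e = {}) \<and>
      (\<forall>x\<in>elts z. \<exists>y\<in>elts z. elts y = insert x (elts x))"
    by metis
qed

end


section \<open>Summation systems\<close>

text \<open>
  A family with entries in \<open>'x\<close> is a partial function on the universe whose domain, its index
  set, is small.  Thus the subfamily of \<open>a\<close> indexed by \<open>J \<subseteq> dom a\<close> is \<open>a |` J\<close>, and
  \<open>a(l \<mapsto> x)\<close>, for \<open>l \<notin> dom a\<close>, is \<open>a\<close> with the entry \<open>x\<close> adjoined at \<open>l\<close>.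
\<close>

type_synonym ('u, 'x) family = "'u \<rightharpoonup> 'x"
type_synonym ('u, 'x) summation = "('u, 'x) family \<rightharpoonup> 'x"

definition is_family :: "('u::set_universe, 'x) family \<Rightarrow> bool" where
  "is_family a \<longleftrightarrow> small (dom a)"

abbreviation entry :: "('u, 'x) family \<Rightarrow> 'u \<Rightarrow> 'x" where
  "entry a i \<equiv> the (a i)"

definition summation_system :: "('u::set_universe, 'x) summation \<Rightarrow> bool" where
  "summation_system S \<longleftrightarrow> (\<forall>a\<in>dom S. is_family a)"

abbreviation summable_in :: "('u, 'x) summation \<Rightarrow> ('u, 'x) family \<Rightarrow> bool" where
  "summable_in S a \<equiv> a \<in> dom S"

abbreviation sum_in :: "('u, 'x) summation \<Rightarrow> ('u, 'x) family \<Rightarrow> 'x" where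
  "sum_in S a \<equiv> the (S a)"

definition properly_extends :: "('u, 'x) summation \<Rightarrow> ('u, 'x) summation \<Rightarrow> bool" where
  "properly_extends S T \<longleftrightarrow> T \<subseteq>\<^sub>m S \<and> S \<noteq> T"

text \<open>
  If the empty family is not summable, the condition on \<open>i\<close> holds throughout \<open>dom a\<close>, so that
  the core of \<open>a\<close> is \<open>a\<close>.
\<close>

definition core :: "('u, 'x) summation \<Rightarrow> ('u, 'x) family \<Rightarrow> ('u, 'x) family" where
  "core S a = a |` {i \<in> dom a. a i \<noteq> S Map.empty}"

definition core_extension ::
  "('u, 'x) summation \<Rightarrow> ('u, 'x) family \<Rightarrow> ('u, 'x) family \<Rightarrow> bool" where
  "core_extension S b a \<longleftrightarrow> a \<subseteq>\<^sub>m b \<and> core S b = core S a"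

definition entry0 :: "('u, 'x::zero) family \<Rightarrow> 'u \<Rightarrow> 'x" where
  "entry0 a i = (case a i of None \<Rightarrow> 0 | Some x \<Rightarrow> x)"

definition family_add ::
  "('u, 'x::{zero, plus}) family \<Rightarrow> ('u, 'x) family \<Rightarrow> ('u, 'x) family" where
  "family_add a b = (\<lambda>i. Some (entry0 a i + entry0 b i)) |` (dom a \<union> dom b)"

definition family_uminus :: "('u, 'x::uminus) family \<Rightarrow> ('u, 'x) family" where
  "family_uminus a = map_option uminus \<circ> a"

definition family_times ::
  "('u::set_universe, 'x::times) family \<Rightarrow> ('u, 'x) family \<Rightarrow> ('u, 'x) family" where
  "family_times a b =
     (\<lambda>p. Some (entry a (vfst p) * entry b (vsnd p))) |` vtimes (dom a) (dom b)"

text \<open>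
  The family of the partial sums \<open>\<Sum>(a\<^sub>i)\<close>, \<open>i \<in> \<psi> k\<close>, for \<open>k \<in> K\<close>.  It is undefined at those
  \<open>k \<in> K\<close> whose partial sum does not exist.
\<close>

definition partial_sums ::
  "('u, 'x) summation \<Rightarrow> ('u, 'x) family \<Rightarrow> 'u set \<Rightarrow> ('u \<Rightarrow> 'u set) \<Rightarrow> ('u, 'x) family" where
  "partial_sums S a K \<psi> = (\<lambda>k. S (a |` \<psi> k)) |` K"

definition sums_via ::
  "('u, 'x) summation \<Rightarrow> ('u, 'x) family \<Rightarrow> 'u set \<Rightarrow> ('u \<Rightarrow> 'u set) \<Rightarrow> bool" where
  "sums_via S a K \<psi> \<longleftrightarrow>
     (\<forall>k\<in>K. summable_in S (a |` \<psi> k)) \<and>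
     summable_in S (partial_sums S a K \<psi>) \<and>
     sum_in S a = sum_in S (partial_sums S a K \<psi>)"


section \<open>Properties of summation systems\<close>

definition reindexing_invariance :: "('u::set_universe, 'x) summation \<Rightarrow> bool" where
  "reindexing_invariance S \<longleftrightarrow> (\<forall>a I' \<phi>.
     summable_in S a \<and> small I' \<and> bij_betw \<phi> I' (dom a) \<longrightarrow>
     summable_in S ((a \<circ> \<phi>) |` I') \<and> sum_in S ((a \<circ> \<phi>) |` I') = sum_in S a)"

definition subfamilies_remain_summable :: "('u, 'x) summation \<Rightarrow> bool" where
  "subfamilies_remain_summable S \<longleftrightarrow>
     (\<forall>a I'. summable_in S a \<and> I' \<subseteq> dom a \<longrightarrow> summable_in S (a |` I'))"

definition empty_sum_existence :: "('u, 'x) summation \<Rightarrow> bool" where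
  "empty_sum_existence S \<longleftrightarrow> summable_in S Map.empty"

definition zero_means_nothing :: "('u::set_universe, 'x) summation \<Rightarrow> bool" where
  "zero_means_nothing S \<longleftrightarrow> (\<forall>a b.
     is_family a \<and> is_family b \<and> core_extension S b a \<longrightarrow>
     (summable_in S b \<longleftrightarrow> summable_in S a) \<and>
     (summable_in S a \<longrightarrow> sum_in S a = sum_in S b))"

definition singletons_sum_simply :: "('u, 'x) summation \<Rightarrow> bool" where
  "singletons_sum_simply S \<longleftrightarrow>
     (\<forall>a i. dom a = {i} \<longrightarrow> summable_in S a \<and> sum_in S a = entry a i)"

definition finite_totality :: "('u, 'x) summation \<Rightarrow> bool" where
  "finite_totality S \<longleftrightarrow> (\<forall>a. finite (dom a) \<longrightarrow> summable_in S a)"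

definition prefix_associativity :: "('u::set_universe, 'x::plus) summation \<Rightarrow> bool" where
  "prefix_associativity S \<longleftrightarrow> (\<forall>a. summable_in S a \<and> dom a = range vnat \<longrightarrow>
     summable_in S ((a \<circ> vsuc) |` range vnat) \<and>
     sum_in S a = entry a (vnat 0) + sum_in S ((a \<circ> vsuc) |` range vnat))"

text \<open>A partition of \<open>I\<close> is here a set \<open>P\<close> of elements of the universe, which are sets.\<close>

definition insertive_associativity :: "('u::set_universe, 'x) summation \<Rightarrow> bool" where
  "insertive_associativity S \<longleftrightarrow> (\<forall>a P.
     summable_in S a \<and> small P \<and> partition_on (dom a) (elts ` P) \<longrightarrow> sums_via S a P elts)"

definition monoid_merger :: "('u::set_universe, 'x) summation \<Rightarrow> bool" where
  "monoid_merger S \<longleftrightarrow> (\<forall>a K \<psi>.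
     summable_in S a \<and> small K \<and> (\<forall>k\<in>K. \<psi> k \<subseteq> dom a) \<and> (\<forall>i\<in>dom a. \<exists>!k. k \<in> K \<and> i \<in> \<psi> k) \<longrightarrow>
     sums_via S a K \<psi>)"

definition additive_extension_closure :: "('u, 'x::plus) summation \<Rightarrow> bool" where
  "additive_extension_closure S \<longleftrightarrow> (\<forall>a l x. summable_in S a \<and> l \<notin> dom a \<longrightarrow>
     summable_in S (a(l \<mapsto> x)) \<and> sum_in S (a(l \<mapsto> x)) = sum_in S a + x)"

definition addition_functoriality :: "('u, 'x::{zero, plus}) summation \<Rightarrow> bool" where
  "addition_functoriality S \<longleftrightarrow> (\<forall>a b. summable_in S a \<and> summable_in S b \<longrightarrow>
     summable_in S (family_add a b) \<and> sum_in S (family_add a b) = sum_in S a + sum_in S b)"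

definition negation_functoriality :: "('u, 'x::uminus) summation \<Rightarrow> bool" where
  "negation_functoriality S \<longleftrightarrow> (\<forall>a. summable_in S a \<longrightarrow>
     summable_in S (family_uminus a) \<and> sum_in S (family_uminus a) = - sum_in S a)"

definition ordinal_reindexing_invariance :: "('u::set_universe, 'x) summation \<Rightarrow> bool" where
  "ordinal_reindexing_invariance S \<longleftrightarrow> (\<forall>a I' \<phi>.
     summable_in S a \<and> dom a \<subseteq> Ord \<and> small I' \<and> I' \<subseteq> Ord \<and>
     bij_betw \<phi> I' (dom a) \<and> (\<forall>i\<in>I'. \<forall>j\<in>I'. i \<lless> j \<longleftrightarrow> \<phi> i \<lless> \<phi> j) \<longrightarrow>
     summable_in S ((a \<circ> \<phi>) |` I') \<and> sum_in S ((a \<circ> \<phi>) |` I') = sum_in S a)"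

definition initial_summability :: "('u::set_universe, 'x) summation \<Rightarrow> bool" where
  "initial_summability S \<longleftrightarrow> (\<forall>a. summable_in S a \<and> dom a \<subseteq> Ord \<longrightarrow>
     (\<forall>\<alpha>\<in>Ord. summable_in S (a |` {j \<in> dom a. j \<lless> \<alpha>})))"

definition postfix_associativity :: "('u::set_universe, 'x::plus) summation \<Rightarrow> bool" where
  "postfix_associativity S \<longleftrightarrow> (\<forall>a m.
     summable_in S a \<and> dom a \<subseteq> Ord \<and> m \<in> dom a \<and> (\<forall>i\<in>dom a - {m}. i \<lless> m) \<longrightarrow>
     summable_in S (a |` (dom a - {m})) \<and>
     sum_in S a = sum_in S (a |` (dom a - {m})) + entry a m)"

definition subinterval :: "'u::set_universe set \<Rightarrow> 'u set \<Rightarrow> bool" where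
  "subinterval J I \<longleftrightarrow>
     J \<subseteq> I \<and> (\<forall>x\<in>J. \<forall>z\<in>J. \<forall>y\<in>I. x \<lless> y \<and> y \<lless> z \<longrightarrow> y \<in> J)"

definition ordinal_insertive_associativity :: "('u::set_universe, 'x) summation \<Rightarrow> bool" where
  "ordinal_insertive_associativity S \<longleftrightarrow> (\<forall>a K J.
     summable_in S a \<and> dom a \<subseteq> Ord \<and>
     (\<forall>k\<in>K. k \<in> J k \<and> subinterval (J k) (dom a)) \<and>
     disjoint_family_on J K \<and> (\<Union>k\<in>K. J k) = dom a \<longrightarrow>
     sums_via S a K J)"

definition infinite_distributivity :: "('u::set_universe, 'x::times) summation \<Rightarrow> bool" where
  "infinite_distributivity S \<longleftrightarrow> (\<forall>a b. summable_in S a \<and> summable_in S b \<longrightarrow>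
     summable_in S (family_times a b) \<and>
     sum_in S a * sum_in S b = sum_in S (family_times a b))"


section \<open>Unconditional summation of real numbers\<close>

definition Sigma_max :: "('u::set_universe, real) summation" where
  "Sigma_max a =
     (if is_family a \<and> (\<exists>!x. (entry a has_sum x) (dom a))
      then Some (THE x. (entry a has_sum x) (dom a)) else None)"

text \<open>The condition on \<open>x\<close>, in terms of neighborhoods of \<open>0\<close>.\<close>

lemma has_sum_iff_neighborhoods:
  fixes f :: "'i \<Rightarrow> real"
  shows "(f has_sum x) I \<longleftrightarrow>
    (\<forall>U. open U \<and> 0 \<in> U \<longrightarrow>
      (\<exists>F. finite F \<and> F \<subseteq> I \<and>
        (\<forall>F'. finite F' \<and> F \<subseteq> F' \<and> F' \<subseteq> I \<longrightarrow> (\<Sum>i\<in>F'. f i) - x \<in> U)))"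
proof -
  have "(f has_sum x) I \<longleftrightarrow>
      ((\<lambda>F. (\<Sum>i\<in>F. f i) - x) \<longlongrightarrow> 0) (finite_subsets_at_top I)"
    unfolding has_sum_def by (rule LIM_zero_iff[symmetric])
  then show ?thesis
    unfolding tendsto_def eventually_finite_subsets_at_top by blast
qed

end

theory Submission
  imports Defs
begin

text \<open>
  A summable family outside \<^const>\<open>Sigma_max\<close> has, up to sign, a nonnegative subfamily with
  unbounded finite sums, from which disjoint finite blocks with sums \<open>b\<^sub>n > 1\<close> can be cut out;
  hence \<open>(b\<^sub>n)\<close> is summable.  By distributivity so is \<open>(b\<^sub>n 2\<^sup>-\<^sup>j)\<close>, indexed by pairs, and
  the binary digits of \<open>1 / b\<^sub>n\<close> select from its \<open>n\<close>-th row a subfamily with sum \<open>1\<close>.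
  Merging these shows that the infinite family with constant entry \<open>1\<close> has a sum \<open>s\<close>, whence
  \<open>s = s + 1\<close>.
\<close>

section \<open>Binary digits and blocks of unbounded nonnegative sums, over the reals\<close>

text \<open>Truncating \<open>r\<close> after \<open>n\<close> binary digits gives
  \<open>\<lfloor>r * 2 ^ n\<rfloor> / 2 ^ n\<close>, which tends to \<open>r\<close>; as the terms
  are nonnegative, convergence in order is already unconditional.\<close>

lemma binary_expansion_has_sum:
  fixes r :: real
  assumes "0 \<le> r" "r < 1"
  shows "((\<lambda>j. (1 / 2) ^ Suc j) has_sum r) {j. odd \<lfloor>r * 2 ^ Suc j\<rfloor>}"
proof -
  \<comment> \<open>Padding with zeros at the digits 0 makes ordinary partial sums available. Index
    \<open>j\<close> stands for the digit of weight \<open>(1 / 2) ^ Suc j\<close>, so the terms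
    with \<open>j < n\<close> are exactly the first \<open>n\<close> digits.\<close>
  define d where "d j = (if odd \<lfloor>r * 2 ^ Suc j\<rfloor> then (1 / 2 :: real) ^ Suc j else 0)" for j
  \<comment> \<open>Doubling appends one binary digit to the integer part, namely the parity of the
    new floor.\<close>
  have floor_double: "\<lfloor>2 * y\<rfloor> = 2 * \<lfloor>y\<rfloor> + (if odd \<lfloor>2 * y\<rfloor> then 1 else 0)" for y :: real
  proof -
    have "\<lfloor>2 * y\<rfloor> = 2 * \<lfloor>y\<rfloor> \<or> \<lfloor>2 * y\<rfloor> = 2 * \<lfloor>y\<rfloor> + 1"
      by linarith
    then show ?thesis
      by auto
  qed
  have partial: "(\<Sum>j<n. d j) = \<lfloor>r * 2 ^ n\<rfloor> / 2 ^ n" for n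
  proof (induction n)
    case 0
    then show ?case
      using assms by (simp add: floor_eq_iff)
  next
    case (Suc n)
    have "r * 2 ^ Suc n = 2 * (r * 2 ^ n)"
      by simp
    then have "\<lfloor>r * 2 ^ Suc n\<rfloor> = 2 * \<lfloor>r * 2 ^ n\<rfloor> + (if odd \<lfloor>r * 2 ^ Suc n\<rfloor> then 1 else 0)"
      using floor_double[of "r * 2 ^ n"] by metis
    then have "real_of_int \<lfloor>r * 2 ^ Suc n\<rfloor> / 2 ^ Suc n = \<lfloor>r * 2 ^ n\<rfloor> / 2 ^ n + d n"
      unfolding d_def by (auto simp: field_simps)
    then show ?case
      using Suc by simp
  qed
  have "(\<lambda>n. \<lfloor>r * 2 ^ n\<rfloor> / 2 ^ n) \<longlonglongrightarrow> r"
  proof (rule real_tendsto_sandwich)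
    show "\<forall>\<^sub>F n in sequentially. r - (1 / 2) ^ n \<le> \<lfloor>r * 2 ^ n\<rfloor> / 2 ^ n"
    proof (rule always_eventually, rule allI)
      fix n :: nat
      have "r * 2 ^ n - 1 \<le> \<lfloor>r * 2 ^ n\<rfloor>"
        by linarith
      then have "(r * 2 ^ n - 1) / 2 ^ n \<le> \<lfloor>r * 2 ^ n\<rfloor> / 2 ^ n"
        by (rule divide_right_mono) simp
      then show "r - (1 / 2) ^ n \<le> \<lfloor>r * 2 ^ n\<rfloor> / 2 ^ n"
        by (simp add: diff_divide_distrib power_one_over)
    qed
    show "\<forall>\<^sub>F n in sequentially. \<lfloor>r * 2 ^ n\<rfloor> / 2 ^ n \<le> r"
      by (simp add: divide_le_eq)
    have "(\<lambda>n. r - (1 / 2 :: real) ^ n) \<longlonglongrightarrow> r - 0"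
      by (intro tendsto_intros LIMSEQ_power_zero) simp
    then show "(\<lambda>n. r - (1 / 2) ^ n) \<longlonglongrightarrow> r"
      by simp
  qed simp
  then have "d sums r"
    by (simp add: sums_def partial)
  then have "(d has_sum r) UNIV"
    by (rule sums_nonneg_imp_has_sum) (simp add: d_def)
  then show ?thesis
    by (rule has_sum_cong_neutral[THEN iffD1, rotated -1]) (auto simp: d_def)
qed

text \<open>The finite sums are unbounded, so there is an increasing chain of finite sets each
  gaining more than 1 over its predecessor; the successive differences are the blocks.\<close>

lemma nonneg_not_summable_on_imp_disjoint_blocks:
  fixes f :: "'i \<Rightarrow> real"
  assumes "\<not> f summable_on A" and nonneg: "\<And>i. i \<in> A \<Longrightarrow> 0 \<le> f i"
  shows "\<exists>F :: nat \<Rightarrow> 'i set.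
    disjoint_family F \<and> (\<forall>n. finite (F n) \<and> F n \<subseteq> A \<and> sum f (F n) > 1)"
proof -
  have unbounded: "\<exists>X. finite X \<and> X \<subseteq> A \<and> c < sum f X" for c
    using nonneg_bdd_above_summable_on[of A f] assms
    by (metis (mono_tags, lifting) bdd_aboveI2 linorder_not_le mem_Collect_eq)
  have "\<exists>G. \<forall>n. (finite (G n) \<and> G n \<subseteq> A) \<and> G n \<subseteq> G (Suc n) \<and> sum f (G n) + 1 < sum f (G (Suc n))"
  proof (rule dependent_nat_choice)
    fix X and n :: nat
    assume X: "finite X \<and> X \<subseteq> A"
    obtain Y where Y: "finite Y" "Y \<subseteq> A" "sum f X + 1 < sum f Y"
      using unbounded by blast
    \<comment> \<open>Passing to the union keeps the chain increasing, and nonnegativity prevents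
      the added terms from lowering the sum.\<close>
    have "sum f Y \<le> sum f (X \<union> Y)"
      using X Y nonneg by (intro sum_mono2) auto
    then show "\<exists>Z. (finite Z \<and> Z \<subseteq> A) \<and> X \<subseteq> Z \<and> sum f X + 1 < sum f Z"
      using X Y by (intro exI[of _ "X \<union> Y"]) auto
  qed auto
  then obtain G where G: "\<And>n. finite (G n)" "\<And>n. G n \<subseteq> A" "\<And>n. G n \<subseteq> G (Suc n)"
      "\<And>n. sum f (G n) + 1 < sum f (G (Suc n))"
    by blast
  have "disjoint_family (\<lambda>n. G (Suc n) - G n)"
    using G(3) by (rule disjoint_family_Suc)
  moreover have "sum f (G (Suc n) - G n) > 1" for n
    using G(4)[of n] sum_diff[OF G(1,3), of f n] by simp
  ultimately show ?thesis
    using G by (intro exI[of _ "\<lambda>n. G (Suc n) - G n"]) auto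
qed

section \<open>Families and sequences over the universe\<close>

lemma small_subset: "small X \<Longrightarrow> Y \<subseteq> X \<Longrightarrow> small Y"
  unfolding small_def using separation[of _ "\<lambda>y. y \<in> Y"]
  by (smt (verit, best) Collect_cong Collect_mem_eq imageE rangeI subset_iff)

lemma vfst_vpair [simp]: "vfst (vpair x y) = x"
  and vsnd_vpair [simp]: "vsnd (vpair x y) = y"
  by (auto simp: vfst_def vsnd_def vpair_inject)

lemma Sigma_max_eq_Some:
  assumes "is_family a" "(entry a has_sum x) (dom a)"
  shows "Sigma_max a = Some x"
proof -
  have "\<exists>!x. (entry a has_sum x) (dom a)"
    using assms(2) has_sum_unique by blast
  then show ?thesis
    using assms by (simp add: Sigma_max_def the1_equality)
qed

text \<open>A sequence is indexed by the values of an injection \<open>e\<close> instead of by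
  \<open>vnat\<close>: the indices can then be chosen inside a small index set, which makes
  \<open>range e\<close> small.\<close>

definition seq_family :: "(nat \<Rightarrow> 'u) \<Rightarrow> (nat \<Rightarrow> 'x) \<Rightarrow> ('u, 'x) family" where
  "seq_family e s = (\<lambda>k. Some (s (inv e k))) |` range e"

lemma dom_seq_family [simp]: "dom (seq_family e s) = range e"
  by (auto simp: seq_family_def restrict_map_def split: if_splits)

lemma seq_family_apply [simp]: "inj e \<Longrightarrow> seq_family e s (e n) = Some (s n)"
  by (simp add: seq_family_def)

section \<open>Consequences of the properties for an extension of \<open>Sigma_max\<close>\<close>

locale unconditional_extension =
  fixes S :: "('u::set_universe, real) summation"
  assumes summation_system: "summation_system S"
    and extends: "Sigma_max \<subseteq>\<^sub>m S"
    and reindexing: "reindexing_invariance S"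
    and subfamilies: "subfamilies_remain_summable S"
    and merger: "monoid_merger S"
    and additive_extension: "additive_extension_closure S"
    and negation: "negation_functoriality S"
    and distributivity: "infinite_distributivity S"
begin

lemma small_dom: "summable_in S a \<Longrightarrow> small (dom a)"
  using summation_system by (auto simp: summation_system_def is_family_def)

lemma eq_Some_of_has_sum:
  assumes "small (dom a)" "(entry a has_sum x) (dom a)"
  shows "S a = Some x"
  using Sigma_max_eq_Some[of a x] extends assms
  by (metis is_family_def domI map_le_def)

lemma summable_restrict: "summable_in S a \<Longrightarrow> J \<subseteq> dom a \<Longrightarrow> summable_in S (a |` J)"
  using subfamilies by (simp add: subfamilies_remain_summable_def)

text \<open>Monoid merger applies to the subfamily over the union of the blocks. It serves twice:
  for finite blocks with sums above 1, and for infinite blocks of binary digits with sum 1.\<close>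

lemma summable_seq_family_of_blocks:
  assumes a: "summable_in S a" and e: "inj e" "small (range e)"
    and G: "disjoint_family G" "\<And>n. G n \<subseteq> dom a"
    and s: "\<And>n. (entry a has_sum s n) (G n)"
  shows "summable_in S (seq_family e s)"
proof -
  define U where "U = (\<Union>n. G n)"
  define \<psi> where "\<psi> k = G (inv e k)" for k
  have U: "U \<subseteq> dom a"
    using G by (auto simp: U_def)
  then have dom_U: "dom (a |` U) = U"
    by auto
  have "summable_in S (a |` U)"
    using a U by (rule summable_restrict)
  moreover have "\<forall>k\<in>range e. \<psi> k \<subseteq> dom (a |` U)"
    unfolding dom_U by (auto simp: \<psi>_def U_def)
  moreover have "\<forall>i\<in>dom (a |` U). \<exists>!k. k \<in> range e \<and> i \<in> \<psi> k"
    unfolding dom_U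
  proof
    fix i
    assume "i \<in> U"
    then obtain n where "i \<in> G n"
      by (auto simp: U_def)
    moreover from this have "m = n" if "i \<in> G m" for m
      using that G(1) by (auto simp: disjoint_family_on_def)
    ultimately show "\<exists>!k. k \<in> range e \<and> i \<in> \<psi> k"
      using e(1) unfolding \<psi>_def by (metis inv_f_f rangeE rangeI)
  qed
  ultimately have "sums_via S (a |` U) (range e) \<psi>"
    using merger e(2) unfolding monoid_merger_def by blast
  moreover have "partial_sums S (a |` U) (range e) \<psi> = seq_family e s"
  proof -
    \<comment> \<open>Each block is summable unconditionally, so the inner sum taken by
      \<open>S\<close> can only be the one given by \<open>Sigma_max\<close>.\<close>
    have "S (a |` U |` G n) = Some (s n)" for n
    proof (rule eq_Some_of_has_sum)
      have dom_G: "dom (a |` U |` G n) = G n"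
        using G(2)[of n] unfolding U_def by (simp add: Int_absorb1 UN_upper Int_assoc)
      show "small (dom (a |` U |` G n))"
        unfolding dom_G using small_dom[OF a] G(2) by (rule small_subset)
      show "(entry (a |` U |` G n) has_sum s n) (dom (a |` U |` G n))"
        unfolding dom_G
        by (rule has_sum_cong[THEN iffD1, OF _ s]) (auto simp: U_def restrict_map_def)
    qed
    then show ?thesis
      by (auto simp: partial_sums_def seq_family_def \<psi>_def restrict_map_def fun_eq_iff)
  qed
  ultimately show ?thesis
    by (simp add: sums_via_def)
qed

text \<open>Hilbert's hotel: the tail \<open>t\<close> reindexes to the whole family by a shift, yet
  adjoining the removed entry 1 to \<open>t\<close> raises the sum by 1.\<close>

lemma constant_not_summable:
  assumes e: "inj e"
  shows "\<not> summable_in S (seq_family e (\<lambda>_. 1))"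
proof
  let ?h = "seq_family e (\<lambda>_. 1 :: real)"
  assume h: "summable_in S ?h"
  define t where "t = ?h |` (range e - {e 0})"
  have dom_t: "dom t = range e - {e 0}"
    by (auto simp: t_def)
  have "summable_in S t"
    unfolding t_def using h by (rule summable_restrict) auto
  have "e 0 \<notin> dom t"
    by (simp add: dom_t)
  then have "sum_in S (t(e 0 \<mapsto> 1)) = sum_in S t + 1"
    using additive_extension \<open>summable_in S t\<close> unfolding additive_extension_closure_def by blast
  moreover have "t(e 0 \<mapsto> 1) = ?h"
    using e by (auto simp: t_def fun_eq_iff restrict_map_def seq_family_def)
  moreover have "sum_in S ?h = sum_in S t"
  proof -
    define \<phi> where "\<phi> k = e (Suc (inv e k))" for k
    have "bij_betw \<phi> (range e) (dom t)"
      unfolding dom_t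
    proof (rule bij_betw_imageI)
      show "inj_on \<phi> (range e)"
        using e by (auto simp: inj_on_def \<phi>_def)
      have "\<phi> ` range e = e ` range Suc"
        using e by (auto simp: \<phi>_def image_image)
      also have "range Suc = UNIV - {0}"
        by (auto simp: image_iff) (metis not0_implies_Suc)
      finally show "\<phi> ` range e = range e - {e 0}"
        using e by (simp add: image_set_diff)
    qed
    moreover have "small (range e)"
      using small_dom[OF h] by simp
    ultimately have "sum_in S ((t \<circ> \<phi>) |` range e) = sum_in S t"
      using reindexing \<open>summable_in S t\<close> unfolding reindexing_invariance_def by blast
    moreover have "(t \<circ> \<phi>) |` range e = ?h"
      using e by (auto simp: t_def \<phi>_def fun_eq_iff restrict_map_def seq_family_def inj_eq)
    ultimately show ?thesis
      by simp
  qed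
  ultimately show False
    by simp
qed

text \<open>The product with a geometric family turns each \<open>b n\<close> into a row of its
  dyadic fractions, from which a subrow of sum 1 can be selected. Merging these subrows contradicts
  \<open>constant_not_summable\<close>.\<close>

lemma seq_family_not_summable:
  assumes e: "inj e" and b: "\<And>n. 1 < b n"
  shows "\<not> summable_in S (seq_family e b)"
proof
  assume summable_b: "summable_in S (seq_family e b)"
  have small_e: "small (range e)"
    using small_dom[OF summable_b] by simp
  define c where "c = seq_family e (\<lambda>j. (1 / 2 :: real) ^ Suc j)"
  have "summable_in S c"
  proof -
    have "((\<lambda>j. (1 / 2 :: real) ^ Suc j) has_sum 1) UNIV"
      by (rule sums_nonneg_imp_has_sum[OF power_half_series]) simp
    then have "(entry c has_sum 1) (range e)"
      using e by (simp add: has_sum_reindex c_def o_def)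
    then show ?thesis
      using eq_Some_of_has_sum[of c 1] small_e by (auto simp: c_def)
  qed
  then have summable_bc: "summable_in S (family_times (seq_family e b) c)"
    using distributivity summable_b by (simp add: infinite_distributivity_def)
  have bc: "family_times (seq_family e b) c (vpair (e n) (e j)) = Some (b n * (1 / 2) ^ Suc j)" for n j
    using e by (auto simp: family_times_def restrict_map_def vtimes_def c_def)
  \<comment> \<open>The part of row \<open>n\<close> at the binary digits 1 of
    \<open>1 / b n\<close>; the first components keep different rows disjoint.\<close>
  define G where
    "G n = (\<lambda>j. vpair (e n) (e j)) ` {j. odd \<lfloor>(1 / b n) * 2 ^ Suc j\<rfloor>}" for n
  have "summable_in S (seq_family e (\<lambda>_. 1))"
    using summable_bc e small_e
  proof (rule summable_seq_family_of_blocks)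
    show "disjoint_family G"
      using e by (auto simp: disjoint_family_on_def G_def vpair_inject inj_eq)
    show "G n \<subseteq> dom (family_times (seq_family e b) c)" for n
      unfolding G_def using bc by blast
    fix n
    \<comment> \<open>Here \<open>1 < b n\<close> is what puts \<open>1 / b n\<close> into the range
      of the binary expansion.\<close>
    have "((\<lambda>j. (1 / 2) ^ Suc j) has_sum 1 / b n) {j. odd \<lfloor>(1 / b n) * 2 ^ Suc j\<rfloor>}"
      using b[of n] by (intro binary_expansion_has_sum) auto
    then have "((\<lambda>j. b n * (1 / 2) ^ Suc j) has_sum b n * (1 / b n))
        {j. odd \<lfloor>(1 / b n) * 2 ^ Suc j\<rfloor>}"
      by (rule has_sum_cmult_right)
    moreover have "inj (\<lambda>j. vpair (e n) (e j))"
      using e by (simp add: inj_def vpair_inject)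
    ultimately show "(entry (family_times (seq_family e b) c) has_sum 1) (G n)"
      unfolding G_def using b[of n]
      by (subst has_sum_reindex) (auto simp: o_def bc intro: inj_on_subset)
  qed
  then show False
    using constant_not_summable[OF e] by blast
qed

text \<open>Otherwise blocks with sums above 1 could be cut out and merged into a summable sequence,
  against \<open>seq_family_not_summable\<close>.\<close>

lemma summable_on_nonneg_part:
  assumes "summable_in S a"
  shows "entry a summable_on {i \<in> dom a. 0 \<le> entry a i}"
proof (rule ccontr)
  assume "\<not> entry a summable_on {i \<in> dom a. 0 \<le> entry a i}"
  then obtain F :: "nat \<Rightarrow> 'u set" where F: "disjoint_family F"
      "\<And>n. finite (F n)" "\<And>n. F n \<subseteq> dom a" "\<And>n. sum (entry a) (F n) > 1"
    using nonneg_not_summable_on_imp_disjoint_blocks[of "entry a" "{i \<in> dom a. 0 \<le> entry a i}"]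
    by blast
  have "F n \<noteq> {}" for n
    using F(4)[of n] by auto
  \<comment> \<open>A representative of each block serves as its index: disjointness makes
    \<open>e\<close> injective, and lying inside \<open>dom a\<close> makes its range small.\<close>
  then have "\<forall>n. \<exists>i. i \<in> F n"
    by blast
  then obtain e where e: "\<And>n. e n \<in> F n"
    by metis
  have "inj e"
    using F(1) e by (metis (mono_tags, lifting) disjoint_family_on_def disjoint_iff injI iso_tuple_UNIV_I)
  moreover have "small (range e)"
    using small_dom[OF assms] by (rule small_subset) (use e F(3) in blast)
  ultimately have "summable_in S (seq_family e (\<lambda>n. sum (entry a) (F n)))"
    using assms F by (intro summable_seq_family_of_blocks[of a e F]) (auto intro: has_sum_finite)
  then show False
    using seq_family_not_summable[OF \<open>inj e\<close>, of "\<lambda>n. sum (entry a) (F n)"] F(4) by blast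
qed

text \<open>The preceding lemma for \<open>a\<close> and for its negative makes both sign parts of
  \<open>a\<close> unconditionally summable, hence \<open>a\<close> itself.\<close>

lemma eq_Sigma_max: "S = Sigma_max"
proof -
  have "Sigma_max a = Some x" if "S a = Some x" for a x
  proof -
    have a: "summable_in S a"
      using that by blast
    then have "summable_in S (family_uminus a)"
      using negation by (simp add: negation_functoriality_def)
    then have "entry (family_uminus a) summable_on
        {i \<in> dom (family_uminus a). 0 \<le> entry (family_uminus a) i}"
      by (rule summable_on_nonneg_part)
    moreover have "{i \<in> dom (family_uminus a). 0 \<le> entry (family_uminus a) i}
        = {i \<in> dom a. entry a i \<le> 0}"
      by (auto simp: family_uminus_def)
    ultimately have "entry (family_uminus a) summable_on {i \<in> dom a. entry a i \<le> 0}"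
      by simp
    then have "(\<lambda>i. - entry a i) summable_on {i \<in> dom a. entry a i \<le> 0}"
      by (rule summable_on_cong[THEN iffD1, rotated]) (auto simp: family_uminus_def)
    then have "entry a summable_on {i \<in> dom a. entry a i \<le> 0}"
      by (simp add: summable_on_uminus)
    \<comment> \<open>The two parts share the indices of zero entries, which does no harm to
      summability on the union.\<close>
    then have "entry a summable_on {i \<in> dom a. 0 \<le> entry a i} \<union> {i \<in> dom a. entry a i \<le> 0}"
      using summable_on_nonneg_part[OF a] by (intro summable_on_union)
    also have "{i \<in> dom a. 0 \<le> entry a i} \<union> {i \<in> dom a. entry a i \<le> 0} = dom a"
      by auto
    finally obtain y where "(entry a has_sum y) (dom a)"
      by (auto simp: summable_on_def)
    then have "Sigma_max a = Some y"
      using small_dom[OF a] by (intro Sigma_max_eq_Some) (simp_all add: is_family_def)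
    \<comment> \<open>So far \<open>y\<close> is only some unconditional sum; since \<open>S\<close>
      extends \<open>Sigma_max\<close>, it equals \<open>x\<close>.\<close>
    then show ?thesis
      using extends that by (metis domI map_le_def)
  qed
  then show ?thesis
    using extends by (intro map_le_antisym) (auto simp: map_le_def)
qed

end

theorem proposition9p2:
  shows "\<not> (\<exists>S :: ('u::set_universe, real) summation.
    summation_system S \<and>
    properly_extends S Sigma_max \<and>
    reindexing_invariance S \<and>
    subfamilies_remain_summable S \<and>
    empty_sum_existence S \<and>
    zero_means_nothing S \<and>
    singletons_sum_simply S \<and>
    finite_totality S \<and>
    prefix_associativity S \<and>
    insertive_associativity S \<and>
    monoid_merger S \<and>
    additive_extension_closure S \<and>
    addition_functoriality S \<and>
    negation_functoriality S \<and>
    ordinal_reindexing_invariance S \<and>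
    initial_summability S \<and>
    postfix_associativity S \<and>
    ordinal_insertive_associativity S \<and>
    infinite_distributivity S)"
proof (rule notI, elim exE conjE)
  fix S :: "('u, real) summation"
  assume "summation_system S" and proper: "properly_extends S Sigma_max"
    and "reindexing_invariance S" "subfamilies_remain_summable S" "monoid_merger S"
      "additive_extension_closure S" "negation_functoriality S" "infinite_distributivity S"
  \<comment> \<open>The inclusion in \<open>proper\<close> supplies \<open>extends\<close>; its
    inequality is what \<open>eq_Sigma_max\<close> then contradicts.\<close>
  then interpret unconditional_extension S
    by unfold_locales (simp_all add: properly_extends_def)
  show False
    using eq_Sigma_max proper by (simp add: properly_extends_def)
qed

end
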